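(* For each $j\ge1$, the $j$-th eigenvalue of the Dirichlet Laplacian in the conical layer $\Pi^\theta$ satisfies $$\lambda_j(\mathcal{A}^{\Pi^\theta})\to\pi^2\qquad\text{as }\theta\to\pi/2,\ \theta\in(0,\pi/2).$$
   Context: For a domain $\Omega$, let $H_0^1(\Omega)$ be the Sobolev space of $H^1(\Omega)$ functions with zero trace on $\partial\Omega$. The Dirichlet Laplacian $\mathcal{A}^{\Omega}$ is the self-adjoint operator in $L_2(\Omega)$ generated by the closed positive form $\mathfrak{a}_\Omega[u,v]=(\nabla u,\nabla v)_{L_2(\Omega)}$ with domain $H_0^1(\Omega)$. For $\theta\in(0,\pi/2)$ the conical layer $\Pi^\theta\subset\mathbb{R}^3$ of unit thickness is the set of points inside an infinite right circular cone with vertex angle $2\theta$ (the angle between generatrix and axis equals $\theta$) whose distance to the lateral surface of the cone is less than one. In cylindrical coordinates $(r,\varphi,z)$ with the apex at the origin and the axis along the $z$-axis, $\Pi^\theta=\{(r,\varphi,z):0<z\sin\theta-r\cos\theta<1\}$. For every $\theta\in(0,\pi/2)$ the essential spectrum of $\mathcal{A}^{\Pi^\theta}$ is $[\pi^2,+\infty)$, and it is known that $\mathcal{A}^{\Pi^\theta}$ has infinitely many eigenvalues below $\pi^2$; they are listed in nondecreasing order, counted with multiplicity, as $\lambda_1(\mathcal{A}^{\Pi^\theta})\le\lambda_2(\mathcal{A}^{\Pi^\theta})\le\cdots$. *)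

theory Defs
  imports "HOL-Analysis.Analysis"
begin

text \<open>
  Elements of the complex space \<open>L\<^sub>2(\<Omega>)\<close> are represented by square-integrable functions; almost
  everywhere equality is taken into account where it matters, that is, in the multiplicity of an
  eigenvalue. Only the values of a function on \<open>\<Omega>\<close> are relevant.
\<close>

definition L2 :: "'a::euclidean_space set \<Rightarrow> ('a \<Rightarrow> complex) set" where
  "L2 \<Omega> = {f. f \<in> borel_measurable (lebesgue_on \<Omega>) \<and>
              integrable (lebesgue_on \<Omega>) (\<lambda>x. (norm (f x))\<^sup>2)}"

definition L2_inner :: "'a::euclidean_space set \<Rightarrow> ('a \<Rightarrow> complex) \<Rightarrow> ('a \<Rightarrow> complex) \<Rightarrow> complex" where
  "L2_inner \<Omega> f g = (LINT x|lebesgue_on \<Omega>. f x * cnj (g x))"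

definition L2_norm :: "'a::euclidean_space set \<Rightarrow> ('a \<Rightarrow> complex) \<Rightarrow> real" where
  "L2_norm \<Omega> f = sqrt (LINT x|lebesgue_on \<Omega>. (norm (f x))\<^sup>2)"

definition L2_lim ::
  "'a::euclidean_space set \<Rightarrow> (nat \<Rightarrow> 'a \<Rightarrow> complex) \<Rightarrow> ('a \<Rightarrow> complex) \<Rightarrow> bool" where
  "L2_lim \<Omega> F f \<longleftrightarrow> (\<lambda>n. L2_norm \<Omega> (\<lambda>x. F n x - f x)) \<longlonglongrightarrow> 0"


definition pd :: "'a::euclidean_space \<Rightarrow> ('a \<Rightarrow> complex) \<Rightarrow> 'a \<Rightarrow> complex" where
  "pd b f x = frechet_derivative f (at x) b"

definition smooth :: "('a::euclidean_space \<Rightarrow> complex) \<Rightarrow> bool" where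
  "smooth f \<longleftrightarrow> (\<forall>bs. set bs \<subseteq> Basis \<longrightarrow> (\<forall>x. foldr pd bs f differentiable (at x)))"

text \<open>The space \<open>C\<^sub>c\<^sup>\<infinity>(\<Omega>)\<close>, its elements being extended by zero to the whole space.\<close>

definition test_fun :: "'a::euclidean_space set \<Rightarrow> ('a \<Rightarrow> complex) set" where
  "test_fun \<Omega> = {\<phi>. smooth \<phi> \<and> compact (closure {x. \<phi> x \<noteq> 0}) \<and> closure {x. \<phi> x \<noteq> 0} \<subseteq> \<Omega>}"


definition is_weak_pd ::
  "'a::euclidean_space set \<Rightarrow> 'a \<Rightarrow> ('a \<Rightarrow> complex) \<Rightarrow> ('a \<Rightarrow> complex) \<Rightarrow> bool" where
  "is_weak_pd \<Omega> b u g \<longleftrightarrow>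
     (\<forall>\<phi>\<in>test_fun \<Omega>. (LINT x|lebesgue_on \<Omega>. u x * pd b \<phi> x) = - (LINT x|lebesgue_on \<Omega>. g x * \<phi> x))"

definition H1 :: "'a::euclidean_space set \<Rightarrow> ('a \<Rightarrow> complex) set" where
  "H1 \<Omega> = {u \<in> L2 \<Omega>. \<forall>b\<in>Basis. \<exists>g\<in>L2 \<Omega>. is_weak_pd \<Omega> b u g}"

text \<open>For \<open>u \<in> H1 \<Omega>\<close>, \<open>\<Omega>\<close> open, the choice below is unique up to a null set.\<close>

definition weak_pd :: "'a::euclidean_space set \<Rightarrow> 'a \<Rightarrow> ('a \<Rightarrow> complex) \<Rightarrow> 'a \<Rightarrow> complex" where
  "weak_pd \<Omega> b u = (SOME g. g \<in> L2 \<Omega> \<and> is_weak_pd \<Omega> b u g)"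

text \<open>
  Zero trace on the boundary is understood, as is usual for general domains, in the sense of the
  closure of \<open>C\<^sub>c\<^sup>\<infinity>(\<Omega>)\<close> in \<open>H\<^sup>1(\<Omega>)\<close>.
\<close>

definition H10 :: "'a::euclidean_space set \<Rightarrow> ('a \<Rightarrow> complex) set" where
  "H10 \<Omega> = {u \<in> H1 \<Omega>. \<exists>\<phi>. (\<forall>n. \<phi> n \<in> test_fun \<Omega>) \<and> L2_lim \<Omega> \<phi> u \<and>
                 (\<forall>b\<in>Basis. L2_lim \<Omega> (\<lambda>n. pd b (\<phi> n)) (weak_pd \<Omega> b u))}"


definition dirichlet_form ::
  "'a::euclidean_space set \<Rightarrow> ('a \<Rightarrow> complex) \<Rightarrow> ('a \<Rightarrow> complex) \<Rightarrow> complex" where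
  "dirichlet_form \<Omega> u v = (\<Sum>b\<in>Basis. L2_inner \<Omega> (weak_pd \<Omega> b u) (weak_pd \<Omega> b v))"

text \<open>
  The graph of the operator generated by the form with domain \<open>H10 \<Omega>\<close> (first representation
  theorem): \<open>u\<close> is in the operator domain with image \<open>f\<close> iff \<open>a[u,v] = (f,v)\<close> for all \<open>v\<close> in the
  form domain.
\<close>

definition dirichlet_laplacian ::
  "'a::euclidean_space set \<Rightarrow> (('a \<Rightarrow> complex) \<times> ('a \<Rightarrow> complex)) set" where
  "dirichlet_laplacian \<Omega> = {(u, f). u \<in> H10 \<Omega> \<and> f \<in> L2 \<Omega> \<and>
                               (\<forall>v\<in>H10 \<Omega>. dirichlet_form \<Omega> u v = L2_inner \<Omega> f v)}"

definition eigenspace :: "'a::euclidean_space set \<Rightarrow> real \<Rightarrow> ('a \<Rightarrow> complex) set" where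
  "eigenspace \<Omega> \<mu> = {u. (u, \<lambda>x. of_real \<mu> * u x) \<in> dirichlet_laplacian \<Omega>}"

text \<open>
  The eigenspace, modulo almost everywhere equality, has a basis with \<open>n\<close> elements. The case
  \<open>n = 0\<close> says that \<open>\<mu>\<close> is not an eigenvalue.
\<close>

definition has_multiplicity :: "'a::euclidean_space set \<Rightarrow> real \<Rightarrow> nat \<Rightarrow> bool" where
  "has_multiplicity \<Omega> \<mu> n \<longleftrightarrow>
     (\<exists>e :: nat \<Rightarrow> 'a \<Rightarrow> complex.
        (\<forall>i<n. e i \<in> eigenspace \<Omega> \<mu>) \<and>
        (\<forall>c :: nat \<Rightarrow> complex.
           (AE x in lebesgue_on \<Omega>. (\<Sum>i<n. c i * e i x) = 0) \<longrightarrow> (\<forall>i<n. c i = 0)) \<and>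
        (\<forall>u\<in>eigenspace \<Omega> \<mu>. \<exists>c :: nat \<Rightarrow> complex.
           AE x in lebesgue_on \<Omega>. u x = (\<Sum>i<n. c i * e i x)))"

text \<open>
  \<open>lam 1 \<le> lam 2 \<le> \<dots>\<close> is the infinite list of all eigenvalues below \<open>\<beta>\<close> of the Dirichlet
  Laplacian in \<open>\<Omega>\<close>, each repeated according to its multiplicity; \<open>lam 0\<close> is irrelevant.
  At most one such list exists.
\<close>

definition lists_eigenvalues_below ::
  "'a::euclidean_space set \<Rightarrow> real \<Rightarrow> (nat \<Rightarrow> real) \<Rightarrow> bool" where
  "lists_eigenvalues_below \<Omega> \<beta> lam \<longleftrightarrow>
     (\<forall>j\<ge>1. lam j < \<beta>) \<and>
     (\<forall>i j. 1 \<le> i \<longrightarrow> i \<le> j \<longrightarrow> lam i \<le> lam j) \<and>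
     (\<forall>\<mu><\<beta>. finite {j. 1 \<le> j \<and> lam j = \<mu>} \<and>
              has_multiplicity \<Omega> \<mu> (card {j. 1 \<le> j \<and> lam j = \<mu>}))"


definition conical_layer :: "real \<Rightarrow> (real^3) set" where
  "conical_layer \<theta> =
     {p. let r = sqrt ((p$1)\<^sup>2 + (p$2)\<^sup>2); z = p$3
         in 0 < z * sin \<theta> - r * cos \<theta> \<and> z * sin \<theta> - r * cos \<theta> < 1}"

end

theory Submission
  imports Defs
begin

text \<open>
  Every line parallel to the axis meets the layer \<open>0 < z sin \<theta> - r cos \<theta> < 1\<close> in a segment of
  length \<open>1 / sin \<theta>\<close>. The Friedrichs inequality on such segments bounds the Dirichlet form below
  by \<open>\<pi>\<^sup>2 sin\<^sup>2 \<theta>\<close> times the squared norm, so that every eigenvalue is at least \<open>\<pi>\<^sup>2 sin\<^sup>2 \<theta>\<close>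
  (\<open>conical_layer_eigenvalue_lower_bound\<close>). The listed eigenvalues lie below \<open>\<pi>\<^sup>2\<close>, and
  \<open>sin \<theta> \<rightarrow> 1\<close>, so the limit follows by squeezing.

  The Friedrichs inequality with the sharp constant is proved directly in \<open>n\<close> dimensions, without
  slicing (\<open>friedrichs_test_fun\<close>). Let \<open>s\<close> be the height above the lower face, measured along the
  unit vector \<open>b\<close>, so that \<open>0 < s < L\<close> on the domain; put \<open>k = \<pi> / L\<close> and let \<open>h = k cot (k s)\<close>,
  the logarithmic derivative along \<open>b\<close> of the one-dimensional ground state \<open>sin (k s)\<close>. It solves the
  Riccati equation \<open>\<partial>h = - k\<^sup>2 - h\<^sup>2\<close>, whence, for a test function \<open>\<phi>\<close>,
  \<open>\<bar>\<partial>\<phi>\<bar>\<^sup>2 - k\<^sup>2 \<bar>\<phi>\<bar>\<^sup>2 = \<bar>\<partial>\<phi> - h \<phi>\<bar>\<^sup>2 + \<partial>(\<bar>\<phi>\<bar>\<^sup>2 h)\<close>. The last term is the derivative of a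
  compactly supported function and integrates to zero
  (\<open>integral_directional_derivative_eq_0\<close>). Density of the test functions carries the inequality
  over to the form domain (\<open>friedrichs_H10\<close>), and an eigenfunction is then tested against itself
  (\<open>eigenvalue_lower_bound\<close>).
\<close>

section \<open>Integrals of directional derivatives\<close>

text \<open>
  By translation invariance of Lebesgue measure, the integrals of the difference quotients vanish;
  dominated convergence passes to the derivative. Only differentiability along \<open>b\<close> is required,
  which matters because the function used below is not differentiable across the axis of the cone.
\<close>

lemma integral_directional_derivative_eq_0:
  fixes F G :: "'a::euclidean_space \<Rightarrow> real" and b :: 'a
  assumes K: "compact K" and F0: "\<And>x. x \<notin> K \<Longrightarrow> F x = 0" and G0: "\<And>x. x \<notin> K \<Longrightarrow> G x = 0"
    and contF: "continuous_on UNIV F" and contG: "continuous_on UNIV G"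
    and deriv: "\<And>x. ((\<lambda>t. F (x + t *\<^sub>R b)) has_real_derivative G x) (at 0)"
  shows "(LINT x|lborel. G x) = 0"
proof -
  have intF: "integrable lborel F"
  proof -
    have "(\<lambda>x. indicator K x *\<^sub>R F x) = F"
      using F0 by (auto simp: indicator_def fun_eq_iff)
    then show ?thesis
      using borel_integrable_compact[OF K continuous_on_subset[OF contF]] by simp
  qed
  have meas: "F \<in> borel_measurable borel" "G \<in> borel_measurable borel"
    using contF contG by (auto intro: borel_measurable_continuous_onI)
  have deriv_at: "((\<lambda>t. F (x + t *\<^sub>R b)) has_real_derivative G (x + t *\<^sub>R b)) (at t)" for x t
    using deriv[of "x + t *\<^sub>R b"] DERIV_shift[of "\<lambda>t. F (x + t *\<^sub>R b)" "G (x + t *\<^sub>R b)" 0 t]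
    by (simp add: algebra_simps)
  obtain M where M: "\<And>x. \<bar>G x\<bar> \<le> M" and "M \<ge> 0"
  proof -
    have "bounded (G ` K)"
      using K contG by (meson compact_continuous_image compact_imp_bounded continuous_on_subset top_greatest)
    then obtain M where "\<And>x. x \<in> K \<Longrightarrow> \<bar>G x\<bar> \<le> M"
      by (auto simp: bounded_iff)
    then have "\<bar>G x\<bar> \<le> max M 0" for x
      using G0[of x] by (cases "x \<in> K") (auto simp: max.coboundedI1)
    then show ?thesis using that[of "max M 0"] by simp
  qed
  have lip: "\<bar>F (x + t *\<^sub>R b) - F x\<bar> \<le> M * \<bar>t\<bar>" for x t
  proof -
    have "norm (F (x + t *\<^sub>R b) - F (x + 0 *\<^sub>R b)) \<le> M * norm (t - 0)"
      by (rule field_differentiable_bound[of UNIV "\<lambda>t. F (x + t *\<^sub>R b)" "\<lambda>t. G (x + t *\<^sub>R b)"])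
        (use deriv_at M in auto)
    then show ?thesis by simp
  qed
  \<comment> \<open>All difference quotients with step at most 1 vanish outside one ball, where \<open>M\<close> dominates them.\<close>
  obtain R where R: "\<And>x. x \<in> K \<Longrightarrow> norm x \<le> R"
    using compact_imp_bounded[OF K] by (auto simp: bounded_iff)
  define h where "h n = inverse (real (Suc n))" for n
  define D where "D n x = (F (x + h n *\<^sub>R b) - F x) / h n" for n x
  have h: "0 < h n" "h n \<le> 1" for n
    by (auto simp: h_def field_simps)
  have h0: "h \<longlonglongrightarrow> 0"
    unfolding h_def by (rule LIMSEQ_inverse_real_of_nat)
  have "(\<lambda>n. LINT x|lborel. D n x) \<longlonglongrightarrow> (LINT x|lborel. G x)"
  proof (rule integral_dominated_convergence[where w="\<lambda>x. indicator (cball 0 (R + norm b)) x *\<^sub>R M"])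
    show "G \<in> borel_measurable lborel" using meas by simp
    show "D n \<in> borel_measurable lborel" for n
      unfolding D_def using meas by measurable
    show "integrable lborel (\<lambda>x. indicator (cball 0 (R + norm b)) x *\<^sub>R M)"
      by (rule borel_integrable_compact) auto
    show "AE x in lborel. (\<lambda>n. D n x) \<longlonglongrightarrow> G x"
    proof (rule AE_I2)
      fix x
      have "((\<lambda>t. (F (x + t *\<^sub>R b) - F x) / t) \<longlongrightarrow> G x) (at 0)"
        using deriv[of x] by (simp add: DERIV_def)
      moreover have "filterlim h (at 0) sequentially"
        using h0 h(1) by (auto simp: filterlim_at intro!: always_eventually) (metis less_irrefl)
      ultimately show "(\<lambda>n. D n x) \<longlonglongrightarrow> G x"
        unfolding D_def by (rule filterlim_compose)
    qed
    show "AE x in lborel. norm (D n x) \<le> indicator (cball 0 (R + norm b)) x *\<^sub>R M" for n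
    proof (rule AE_I2)
      fix x
      have "norm (D n x) \<le> M"
        using lip[of x "h n"] h[of n] by (simp add: D_def field_simps)
      moreover have "D n x = 0" if "R + norm b < norm x"
      proof -
        have "norm (h n *\<^sub>R b) \<le> norm b"
          using h[of n] by (simp add: mult_left_le_one_le)
        moreover have "norm x \<le> norm (x + h n *\<^sub>R b) + norm (h n *\<^sub>R b)"
          using norm_triangle_ineq4[of "x + h n *\<^sub>R b" "h n *\<^sub>R b"] by simp
        ultimately have "x + h n *\<^sub>R b \<notin> K" "x \<notin> K"
          using R[of x] R[of "x + h n *\<^sub>R b"] that norm_ge_zero[of b] by linarith+
        then show ?thesis by (simp add: D_def F0)
      qed
      ultimately show "norm (D n x) \<le> indicator (cball 0 (R + norm b)) x *\<^sub>R M"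
        by (auto simp: indicator_def not_le)
    qed
  qed
  moreover have "(LINT x|lborel. D n x) = 0" for n
  proof -
    let ?c = "h n *\<^sub>R b"
    have "integrable (distr lborel borel ((+) ?c)) F" using intF by (simp add: lborel_distr_plus)
    then have int': "integrable lborel (\<lambda>x. F (x + ?c))"
      using meas by (subst (asm) integrable_distr_eq) (auto simp: add.commute)
    have "(LINT x|lborel. F x) = (LINT x|distr lborel borel ((+) ?c). F x)"
      by (simp add: lborel_distr_plus)
    also have "\<dots> = (LINT x|lborel. F (x + ?c))"
      using meas by (subst integral_distr) (auto simp: add.commute)
    finally show ?thesis
      using intF int' by (simp add: D_def)
  qed
  ultimately show ?thesis
    by (simp add: LIMSEQ_const_iff)
qed

section \<open>Test functions\<close>

lemma test_fun_off_support:
  assumes "\<phi> \<in> test_fun \<Omega>" and "x \<notin> closure {x. \<phi> x \<noteq> 0}"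
  shows "\<phi> x = 0" and "pd b \<phi> x = 0"
proof -
  let ?K = "closure {x. \<phi> x \<noteq> 0}"
  have z: "\<phi> y = 0" if "y \<notin> ?K" for y
    using that closure_subset[of "{x. \<phi> x \<noteq> 0}"] by blast
  show "\<phi> x = 0" using z assms(2) .
  have "((\<lambda>_. 0) has_derivative (\<lambda>_. 0)) (at x)" by simp
  then have "(\<phi> has_derivative (\<lambda>_. 0)) (at x)"
  proof (rule has_derivative_transform_within_open[where s="- ?K"])
    show "open (- ?K)" by (simp only: open_Compl closed_closure)
    show "x \<in> - ?K" using assms(2) by (simp only: Compl_iff not_False_eq_True)
    show "0 = \<phi> y" if "y \<in> - ?K" for y using z[of y] that by (metis ComplD)
  qed
  then show "pd b \<phi> x = 0"
    unfolding pd_def by (simp only: frechet_derivative_at[symmetric])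
qed

lemma test_fun_continuous:
  assumes "\<phi> \<in> test_fun \<Omega>" and "b \<in> Basis"
  shows "continuous_on S \<phi>" and "continuous_on S (pd b \<phi>)"
proof -
  have "smooth \<phi>" using assms by (simp add: test_fun_def)
  then have "foldr pd [] \<phi> differentiable (at x)" "foldr pd [b] \<phi> differentiable (at x)" for x
    unfolding smooth_def using assms(2) by (metis empty_set empty_subsetI, metis
      empty_set empty_subsetI insert_subset list.simps(15))
  then have "\<And>x. isCont \<phi> x" "\<And>x. isCont (pd b \<phi>) x"
    by (auto intro: differentiable_imp_continuous_within)
  then show "continuous_on S \<phi>" "continuous_on S (pd b \<phi>)"
    by (auto intro: continuous_at_imp_continuous_on)
qed

lemma test_fun_has_pd:
  assumes "\<phi> \<in> test_fun \<Omega>"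
  shows "((\<lambda>t. \<phi> (x + t *\<^sub>R b)) has_vector_derivative pd b \<phi> x) (at 0)"
proof -
  have "smooth \<phi>" using assms by (simp add: test_fun_def)
  then have "foldr pd [] \<phi> differentiable (at x)"
    unfolding smooth_def by (metis empty_set empty_subsetI)
  then have "(\<phi> has_derivative frechet_derivative \<phi> (at x)) (at x)"
    by (simp add: frechet_derivative_works)
  then have D: "(\<phi> has_derivative frechet_derivative \<phi> (at x)) (at (x + 0 *\<^sub>R b))"
    by simp
  have "((\<lambda>t. x + t *\<^sub>R b) has_derivative (\<lambda>t. t *\<^sub>R b)) (at (0::real))"
    by (auto intro!: derivative_eq_intros)
  from has_derivative_compose[OF this D]
  show ?thesis
    unfolding has_vector_derivative_def pd_def
    using linear_frechet_derivative[of \<phi> "at x"] \<open>foldr pd [] \<phi> differentiable (at x)\<close>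
    by (simp add: linear_cmul)
qed

lemma continuous_on_zero_extension:
  fixes f :: "'a::t2_space \<Rightarrow> 'b::{t2_space,zero}"
  assumes "open \<Omega>" "compact K" "K \<subseteq> \<Omega>" "continuous_on \<Omega> f" "\<And>x. x \<notin> K \<Longrightarrow> f x = 0"
  shows "continuous_on UNIV f"
proof -
  have "continuous_on (- K) f"
    using assms(5) by (subst continuous_on_cong[OF refl, where g="\<lambda>_. 0"]) auto
  then have "continuous_on (\<Omega> \<union> - K) f"
    using assms by (intro continuous_on_open_Un) (auto simp: compact_imp_closed)
  moreover have "\<Omega> \<union> - K = UNIV" using assms(3) by auto
  ultimately show ?thesis by simp
qed

lemma integrable_lebesgue_on_compact_support:
  fixes f :: "'a::euclidean_space \<Rightarrow> 'b::euclidean_space"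
  assumes "open \<Omega>" "compact K" "K \<subseteq> \<Omega>" "continuous_on UNIV f" "\<And>x. x \<notin> K \<Longrightarrow> f x = 0"
  shows "integrable (lebesgue_on \<Omega>) f" 
    and "(LINT x|lebesgue_on \<Omega>. f x) = (LINT x|lborel. f x)"
proof -
  have "integrable lborel (\<lambda>x. indicator K x *\<^sub>R f x)"
    using assms continuous_on_subset by (intro borel_integrable_compact) blast+
  moreover have "(\<lambda>x. indicator K x *\<^sub>R f x) = f"
    using assms(5) by (auto simp: indicator_def fun_eq_iff)
  ultimately have I: "integrable lborel f" by simp
  have meas: "f \<in> borel_measurable lborel"
    using assms(4) by (simp add: borel_measurable_continuous_onI)
  have ext: "(\<lambda>x. indicator \<Omega> x *\<^sub>R f x) = f"
    using assms(3,5) by (auto simp: indicator_def fun_eq_iff)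
  have \<Omega>: "\<Omega> \<inter> space lebesgue \<in> sets lebesgue"
    using assms(1) by (auto intro: sets_completionI_sets)
  show "integrable (lebesgue_on \<Omega>) f"
    using I integrable_completion[OF meas] by (simp add: integrable_restrict_space[OF \<Omega>] ext)
  show "(LINT x|lebesgue_on \<Omega>. f x) = (LINT x|lborel. f x)"
    using integral_completion[OF meas] by (simp add: integral_restrict_space[OF \<Omega>] ext)
qed

lemma test_fun_in_L2:
  assumes "open \<Omega>" "\<phi> \<in> test_fun \<Omega>" "b \<in> Basis"
  shows "\<phi> \<in> L2 \<Omega>" and "pd b \<phi> \<in> L2 \<Omega>"
proof -
  let ?K = "closure {x. \<phi> x \<noteq> 0}"
  have K: "compact ?K" "?K \<subseteq> \<Omega>" using assms by (auto simp: test_fun_def)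
  have *: "f \<in> L2 \<Omega>" if "continuous_on UNIV f" "\<And>x. x \<notin> ?K \<Longrightarrow> f x = 0" for f :: "'a \<Rightarrow> complex"
  proof -
    have "integrable (lebesgue_on \<Omega>) f"
      by (rule integrable_lebesgue_on_compact_support(1)[OF assms(1) K that])
    moreover have "integrable (lebesgue_on \<Omega>) (\<lambda>x. (norm (f x))\<^sup>2)"
      using that by (intro integrable_lebesgue_on_compact_support(1)[OF assms(1) K] continuous_intros) auto
    ultimately show ?thesis by (simp add: L2_def)
  qed
  note cont = test_fun_continuous[OF assms(2,3)] and off = test_fun_off_support[OF assms(2)]
  show "\<phi> \<in> L2 \<Omega>" by (rule *[OF cont(1) off(1)])
  show "pd b \<phi> \<in> L2 \<Omega>" by (rule *[OF cont(2) off(2)])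
qed

section \<open>The Friedrichs inequality\<close>

text \<open>
  The hypotheses on \<open>s\<close> say that the domain lies between two graphs over the hyperplane
  orthogonal to \<open>b\<close>, at distance \<open>L\<close> from each other in the direction \<open>b\<close>.
\<close>

lemma friedrichs_test_fun:
  fixes \<Omega> :: "'a::euclidean_space set" and s :: "'a \<Rightarrow> real"
  assumes \<Omega>: "open \<Omega>" and b: "b \<in> Basis" and "L > 0"
    and s: "continuous_on UNIV s" "\<And>x t. s (x + t *\<^sub>R b) = s x + t"
    and s\<Omega>: "\<And>x. x \<in> \<Omega> \<Longrightarrow> 0 < s x \<and> s x < L"
    and \<phi>: "\<phi> \<in> test_fun \<Omega>"
  shows "(pi / L)\<^sup>2 * (LINT x|lebesgue_on \<Omega>. (norm (\<phi> x))\<^sup>2)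
           \<le> (LINT x|lebesgue_on \<Omega>. (norm (pd b \<phi> x))\<^sup>2)"
proof -
  \<comment> \<open>\<open>h\<close> is the derivative of \<open>ln (sin (k s))\<close> along \<open>b\<close>; \<open>G\<close> is that of \<open>F\<close>, by the Riccati equation.
    On the support of \<open>\<phi>\<close>, \<open>k s\<close> stays away from the poles \<open>0\<close> and \<open>\<pi>\<close> of the cotangent.\<close>
  define k where "k = pi / L"
  define h where "h x = k * cot (k * s x)" for x
  define F where "F x = (norm (\<phi> x))\<^sup>2 * h x" for x
  define G where "G x = 2 * (\<phi> x \<bullet> pd b \<phi> x) * h x - (norm (\<phi> x))\<^sup>2 * (k\<^sup>2 + (h x)\<^sup>2)" for x
  let ?K = "closure {x. \<phi> x \<noteq> 0}"
  have K: "compact ?K" "?K \<subseteq> \<Omega>" using \<phi> by (auto simp: test_fun_def)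
  note off = test_fun_off_support[OF \<phi>]
  note cont = test_fun_continuous[OF \<phi> b]
  have sin_pos: "sin (k * s x) > 0" if "x \<in> \<Omega>" for x
  proof (rule sin_gt_zero)
    show "0 < k * s x" using s\<Omega>[OF that] \<open>L > 0\<close> by (simp add: k_def)
    show "k * s x < pi" using s\<Omega>[OF that] \<open>L > 0\<close> by (simp add: k_def field_simps)
  qed
  have conth: "continuous_on \<Omega> h"
    unfolding h_def cot_def using sin_pos continuous_on_subset[OF s(1)]
    by (intro continuous_intros) (auto simp: less_le)
  have F_off: "F x = 0" if "x \<notin> ?K" for x
    by (simp only: F_def off[OF that]) simp
  have contF: "continuous_on UNIV F"
  proof (rule continuous_on_zero_extension[OF \<Omega> K])
    show "continuous_on \<Omega> F"
      unfolding F_def by (intro continuous_intros conth cont)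
  qed (rule F_off)
  have G_off: "G x = 0" if "x \<notin> ?K" for x
    by (simp only: G_def off[OF that]) simp
  have contG: "continuous_on UNIV G"
  proof (rule continuous_on_zero_extension[OF \<Omega> K])
    show "continuous_on \<Omega> G"
      unfolding G_def by (intro continuous_intros conth cont)
  qed (rule G_off)
  have deriv: "((\<lambda>t. F (x + t *\<^sub>R b)) has_real_derivative G x) (at 0)" for x
  proof (cases "x \<in> \<Omega>")
    case True
    have D: "((\<lambda>t. \<phi> (x + t *\<^sub>R b)) has_derivative (\<lambda>t. t *\<^sub>R pd b \<phi> x)) (at 0)"
      using test_fun_has_pd[OF \<phi>, of x b] by (simp only: has_vector_derivative_def)
    have "((\<lambda>t. \<phi> (x + t *\<^sub>R b) \<bullet> \<phi> (x + t *\<^sub>R b)) has_derivative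
            (\<lambda>t. \<phi> (x + 0 *\<^sub>R b) \<bullet> (t *\<^sub>R pd b \<phi> x) + (t *\<^sub>R pd b \<phi> x) \<bullet> \<phi> (x + 0 *\<^sub>R b))) (at 0)"
      by (rule has_derivative_inner[OF D D])
    then have 1: "((\<lambda>t. (norm (\<phi> (x + t *\<^sub>R b)))\<^sup>2) has_real_derivative 2 * (\<phi> x \<bullet> pd b \<phi> x)) (at 0)"
      unfolding has_field_derivative_def power2_norm_eq_inner
      by (rule has_derivative_eq_rhs) (auto simp: inner_commute algebra_simps)
    have sn: "sin (k * s x) \<noteq> 0" using sin_pos[OF True] by simp
    have "((\<lambda>t. k * cot (k * (s x + t))) has_real_derivative
             k * (- inverse ((sin (k * (s x + 0)))\<^sup>2) * k)) (at 0)"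
      using sn by (intro DERIV_cmult DERIV_chain2[where f=cot] DERIV_cot) 
        (auto intro!: derivative_eq_intros)
    moreover have "k * (- inverse ((sin (k * (s x + 0)))\<^sup>2) * k) = - (k\<^sup>2 + (h x)\<^sup>2)"
    proof -
      have "k\<^sup>2 + (k * (C / S))\<^sup>2 = k\<^sup>2 * (S\<^sup>2 + C\<^sup>2) / S\<^sup>2" if "S \<noteq> 0" for C S :: real
        using that by (simp add: field_simps power2_eq_square)
      from this[OF sn, of "cos (k * s x)"] have "k\<^sup>2 + (h x)\<^sup>2 = k\<^sup>2 / (sin (k * s x))\<^sup>2"
        by (simp only: h_def cot_def sin_cos_squared_add mult_1_right)
      then show ?thesis
        by (simp add: divide_inverse power2_eq_square)
    qed
    ultimately have 2: "((\<lambda>t. h (x + t *\<^sub>R b)) has_real_derivative - (k\<^sup>2 + (h x)\<^sup>2)) (at 0)"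
      by (simp add: h_def s(2))
    show ?thesis
      using DERIV_mult[OF 1 2] by (simp add: F_def G_def algebra_simps)
  next
    case False
    then have nK: "x \<notin> ?K" using K by auto
    have "open ((\<lambda>t. x + t *\<^sub>R b) -` (- ?K))"
      by (intro open_vimage) (auto intro!: continuous_intros)
    then have "((\<lambda>t. F (x + t *\<^sub>R b)) has_real_derivative 0) (at 0)"
      using DERIV_const[of "0::real" "at 0"] nK
      by (rule_tac has_field_derivative_transform_within_open[where f="\<lambda>_. 0" and S="(\<lambda>t. x + t *\<^sub>R b) -` (- ?K)"])
        (auto simp: F_off)
    then show ?thesis by (simp only: G_off[OF nK])
  qed
  have G0: "(LINT x|lborel. G x) = 0"
    by (rule integral_directional_derivative_eq_0[OF K(1) F_off G_off contF contG deriv])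
  have int\<phi>: "integrable (lebesgue_on \<Omega>) (\<lambda>x. (norm (\<phi> x))\<^sup>2)"
    and intpd: "integrable (lebesgue_on \<Omega>) (\<lambda>x. (norm (pd b \<phi> x))\<^sup>2)"
    using test_fun_in_L2[OF \<Omega> \<phi> b] by (auto simp: L2_def)
  have intG: "integrable (lebesgue_on \<Omega>) G" and G0': "(LINT x|lebesgue_on \<Omega>. G x) = 0"
    using integrable_lebesgue_on_compact_support[OF \<Omega> K contG G_off] G0 by simp_all
  have "G x + k\<^sup>2 * (norm (\<phi> x))\<^sup>2 \<le> (norm (pd b \<phi> x))\<^sup>2" for x
  proof -
    have "0 \<le> (norm (pd b \<phi> x - h x *\<^sub>R \<phi> x))\<^sup>2" by simp
    also have "\<dots> = (norm (pd b \<phi> x))\<^sup>2 - 2 * (\<phi> x \<bullet> pd b \<phi> x) * h x + (h x)\<^sup>2 * (norm (\<phi> x))\<^sup>2"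
      unfolding power2_norm_eq_inner
      by (simp add: inner_diff_left inner_diff_right inner_commute algebra_simps power2_eq_square)
    finally show ?thesis by (simp add: G_def algebra_simps)
  qed
  then have "(LINT x|lebesgue_on \<Omega>. G x + k\<^sup>2 * (norm (\<phi> x))\<^sup>2) \<le> (LINT x|lebesgue_on \<Omega>. (norm (pd b \<phi> x))\<^sup>2)"
    using int\<phi> intpd intG by (intro integral_mono) auto
  then show ?thesis
    using int\<phi> intG G0' by (simp add: k_def)
qed

section \<open>Convergence of norms in \<open>L\<^sub>2\<close>\<close>

text \<open>
  The expansion of \<open>\<bar>c + (a - c)\<bar>\<^sup>2\<close> with Young's inequality for the mixed term. Integrated, it
  replaces the Cauchy-Schwarz inequality in the proof of the triangle inequality in \<open>L\<^sub>2\<close>.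
\<close>

lemma norm_sq_le_weighted:
  fixes a c :: "'a::real_inner"
  assumes "\<delta> > 0"
  shows "(norm a)\<^sup>2 \<le> (1 + \<delta>) * (norm c)\<^sup>2 + (1 + 1 / \<delta>) * (norm (a - c))\<^sup>2"
proof -
  define d where "d = a - c"
  have a: "a = c + d" by (simp add: d_def)
  have "0 \<le> (norm (\<delta> *\<^sub>R c - d))\<^sup>2 / \<delta>" using assms by simp
  also have "\<dots> = \<delta> * (norm c)\<^sup>2 - 2 * (c \<bullet> d) + (norm d)\<^sup>2 / \<delta>"
    unfolding power2_norm_eq_inner using assms
    by (simp add: inner_diff_left inner_diff_right inner_commute field_simps power2_eq_square)
  finally have "2 * (c \<bullet> d) \<le> \<delta> * (norm c)\<^sup>2 + (norm d)\<^sup>2 / \<delta>" by simp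
  moreover have "(norm a)\<^sup>2 = (norm c)\<^sup>2 + 2 * (c \<bullet> d) + (norm d)\<^sup>2"
    unfolding a power2_norm_eq_inner by (simp add: inner_add_left inner_add_right inner_commute)
  ultimately show ?thesis by (simp add: d_def[symmetric] algebra_simps)
qed

lemma L2_diff_sq_integrable:
  assumes "f \<in> L2 \<Omega>" "g \<in> L2 \<Omega>"
  shows "integrable (lebesgue_on \<Omega>) (\<lambda>x. (norm (f x - g x))\<^sup>2)"
proof (rule Bochner_Integration.integrable_bound)
  show "integrable (lebesgue_on \<Omega>) (\<lambda>x. 2 * (norm (f x))\<^sup>2 + 2 * (norm (g x))\<^sup>2)"
    using assms by (auto simp: L2_def)
  have "f \<in> borel_measurable (lebesgue_on \<Omega>)" "g \<in> borel_measurable (lebesgue_on \<Omega>)"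
    using assms by (auto simp: L2_def)
  then show "(\<lambda>x. (norm (f x - g x))\<^sup>2) \<in> borel_measurable (lebesgue_on \<Omega>)"
    by measurable
  show "AE x in lebesgue_on \<Omega>. norm ((norm (f x - g x))\<^sup>2) \<le> norm (2 * (norm (f x))\<^sup>2 + 2 * (norm (g x))\<^sup>2)"
  proof (rule AE_I2)
    fix x
    show "norm ((norm (f x - g x))\<^sup>2) \<le> norm (2 * (norm (f x))\<^sup>2 + 2 * (norm (g x))\<^sup>2)"
      using norm_sq_le_weighted[of 1 "f x - g x" "f x"] by simp
  qed
qed


text \<open>
  For \<open>\<delta> = D / B\<close> the right-hand side equals \<open>(B + D)\<^sup>2\<close>. As \<open>B\<close> or \<open>D\<close> may vanish, both are
  first increased by \<open>e / 2\<close>.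
\<close>

lemma le_add_of_weighted_sq:
  fixes A B D :: real
  assumes "B \<ge> 0" "D \<ge> 0" and w: "\<And>\<delta>. \<delta> > 0 \<Longrightarrow> A\<^sup>2 \<le> (1 + \<delta>) * B\<^sup>2 + (1 + 1 / \<delta>) * D\<^sup>2"
  shows "A \<le> B + D"
proof (rule field_le_epsilon)
  fix e :: real assume "e > 0"
  define e' where "e' = e / 2"
  have pos: "B + e' > 0" "D + e' > 0" using assms \<open>e > 0\<close> by (auto simp: e'_def)
  have "B\<^sup>2 / (B + e') \<le> B" "D\<^sup>2 / (D + e') \<le> D"
    using assms pos \<open>e > 0\<close> by (auto simp: field_simps power2_eq_square e'_def)
  then have *: "(B + D + e) * (B\<^sup>2 / (B + e') + D\<^sup>2 / (D + e')) \<le> (B + D + e) * (B + D + e)"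
    using assms \<open>e > 0\<close> by (intro mult_left_mono) auto
  have "A\<^sup>2 \<le> (1 + (D + e') / (B + e')) * B\<^sup>2 + (1 + 1 / ((D + e') / (B + e'))) * D\<^sup>2"
    using pos by (intro w) simp
  also have "1 + (D + e') / (B + e') = (B + D + e) / (B + e')"
    using pos by (simp add: field_simps e'_def)
  also have "1 + 1 / ((D + e') / (B + e')) = (B + D + e) / (D + e')"
    using pos by (simp add: field_simps e'_def)
  also have "(B + D + e) / (B + e') * B\<^sup>2 + (B + D + e) / (D + e') * D\<^sup>2
      = (B + D + e) * (B\<^sup>2 / (B + e') + D\<^sup>2 / (D + e'))"
    by (simp add: algebra_simps)
  finally have "A\<^sup>2 \<le> (B + D + e)\<^sup>2"
    using * by (simp add: power2_eq_square)
  then show "A \<le> B + D + e"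
    by (rule power2_le_imp_le) (use assms \<open>e > 0\<close> in auto)
qed

lemma L2_norm_nonneg: "L2_norm \<Omega> f \<ge> 0"
  by (simp add: L2_norm_def)

lemma L2_norm_sq: "(L2_norm \<Omega> f)\<^sup>2 = (LINT x|lebesgue_on \<Omega>. (norm (f x))\<^sup>2)"
  by (simp add: L2_norm_def)

lemma L2_norm_triangle:
  assumes "f \<in> L2 \<Omega>" "g \<in> L2 \<Omega>"
  shows "L2_norm \<Omega> f \<le> L2_norm \<Omega> g + L2_norm \<Omega> (\<lambda>x. f x - g x)"
proof (rule le_add_of_weighted_sq[OF L2_norm_nonneg L2_norm_nonneg])
  fix \<delta> :: real assume "\<delta> > 0"
  have I: "integrable (lebesgue_on \<Omega>) (\<lambda>x. (norm (f x))\<^sup>2)" "integrable (lebesgue_on \<Omega>) (\<lambda>x. (norm (g x))\<^sup>2)"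
    using assms by (auto simp: L2_def)
  note I = I L2_diff_sq_integrable[OF assms]
  have "(LINT x|lebesgue_on \<Omega>. (norm (f x))\<^sup>2)
      \<le> (LINT x|lebesgue_on \<Omega>. (1 + \<delta>) * (norm (g x))\<^sup>2 + (1 + 1 / \<delta>) * (norm (f x - g x))\<^sup>2)"
    using I by (intro integral_mono norm_sq_le_weighted \<open>\<delta> > 0\<close>) auto
  then show "(L2_norm \<Omega> f)\<^sup>2 \<le> (1 + \<delta>) * (L2_norm \<Omega> g)\<^sup>2 + (1 + 1 / \<delta>) * (L2_norm \<Omega> (\<lambda>x. f x - g x))\<^sup>2"
    using I by (simp add: L2_norm_sq)
qed

lemma L2_lim_norm:
  assumes "\<And>n. F n \<in> L2 \<Omega>" "f \<in> L2 \<Omega>" "L2_lim \<Omega> F f"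
  shows "(\<lambda>n. L2_norm \<Omega> (F n)) \<longlonglongrightarrow> L2_norm \<Omega> f"
proof (rule LIM_zero_cancel, rule Lim_null_comparison)
  show "(\<lambda>n. L2_norm \<Omega> (\<lambda>x. F n x - f x)) \<longlonglongrightarrow> 0"
    using assms(3) by (simp add: L2_lim_def)
  have "L2_norm \<Omega> (\<lambda>x. f x - F n x) = L2_norm \<Omega> (\<lambda>x. F n x - f x)" for n
    by (simp add: L2_norm_def norm_minus_commute)
  then show "\<forall>\<^sub>F n in sequentially. norm (L2_norm \<Omega> (F n) - L2_norm \<Omega> f) \<le> L2_norm \<Omega> (\<lambda>x. F n x - f x)"
    using L2_norm_triangle[OF assms(1,2)] L2_norm_triangle[OF assms(2,1)]
    by (intro always_eventually allI) (simp add: abs_le_iff, smt (verit))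
qed

section \<open>Eigenvalues of domains of bounded width in one direction\<close>

lemma weak_pd_in_L2:
  assumes "u \<in> H1 \<Omega>" "b \<in> Basis"
  shows "weak_pd \<Omega> b u \<in> L2 \<Omega>"
proof -
  have "\<exists>g. g \<in> L2 \<Omega> \<and> is_weak_pd \<Omega> b u g" using assms by (auto simp: H1_def)
  from someI_ex[OF this] show ?thesis by (simp add: weak_pd_def)
qed

lemma friedrichs_H10:
  fixes \<Omega> :: "'a::euclidean_space set" and s :: "'a \<Rightarrow> real"
  assumes \<Omega>: "open \<Omega>" and b: "b \<in> Basis" and "L > 0"
    and s: "continuous_on UNIV s" "\<And>x t. s (x + t *\<^sub>R b) = s x + t"
      "\<And>x. x \<in> \<Omega> \<Longrightarrow> 0 < s x \<and> s x < L"
    and u: "u \<in> H10 \<Omega>"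
  shows "pi / L * L2_norm \<Omega> u \<le> L2_norm \<Omega> (weak_pd \<Omega> b u)"
proof -
  obtain \<phi> where \<phi>: "\<And>n. \<phi> n \<in> test_fun \<Omega>" and lim: "L2_lim \<Omega> \<phi> u"
      "L2_lim \<Omega> (\<lambda>n. pd b (\<phi> n)) (weak_pd \<Omega> b u)"
    using u b by (auto simp: H10_def)
  have u1: "u \<in> H1 \<Omega>" "u \<in> L2 \<Omega>" using u by (auto simp: H10_def H1_def)
  have "pi / L * L2_norm \<Omega> (\<phi> n) \<le> L2_norm \<Omega> (pd b (\<phi> n))" for n
  proof (rule power2_le_imp_le)
    show "(pi / L * L2_norm \<Omega> (\<phi> n))\<^sup>2 \<le> (L2_norm \<Omega> (pd b (\<phi> n)))\<^sup>2"
      using friedrichs_test_fun[OF \<Omega> b \<open>L > 0\<close> s \<phi>] by (simp only: power_mult_distrib L2_norm_sq)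
  qed (rule L2_norm_nonneg)
  moreover have "(\<lambda>n. pi / L * L2_norm \<Omega> (\<phi> n)) \<longlonglongrightarrow> pi / L * L2_norm \<Omega> u"
    by (intro tendsto_mult_left L2_lim_norm lim u1 test_fun_in_L2(1)[OF \<Omega> \<phi> b])
  moreover have "(\<lambda>n. L2_norm \<Omega> (pd b (\<phi> n))) \<longlonglongrightarrow> L2_norm \<Omega> (weak_pd \<Omega> b u)"
    by (intro L2_lim_norm lim weak_pd_in_L2[OF u1(1) b] test_fun_in_L2(2)[OF \<Omega> \<phi> b])
  ultimately show ?thesis
    by (intro LIMSEQ_le) auto
qed

lemma L2_inner_self: "L2_inner \<Omega> f f = of_real ((L2_norm \<Omega> f)\<^sup>2)"
  unfolding L2_inner_def L2_norm_sq complex_norm_square[symmetric]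
  by (rule integral_complex_of_real)

text \<open>
  Testing the eigenvalue equation with \<open>u\<close> itself gives \<open>\<Sum>\<^sub>b \<bar>\<partial>\<^sub>b u\<bar>\<^sup>2 = \<mu> \<bar>u\<bar>\<^sup>2\<close> for the norms
  in \<open>L\<^sub>2\<close>; a single direction on the left is already at least \<open>(\<pi> / L)\<^sup>2 \<bar>u\<bar>\<^sup>2\<close>.
\<close>

lemma eigenvalue_lower_bound:
  fixes \<Omega> :: "'a::euclidean_space set" and s :: "'a \<Rightarrow> real"
  assumes \<Omega>: "open \<Omega>" and b: "b \<in> Basis" and "L > 0"
    and s: "continuous_on UNIV s" "\<And>x t. s (x + t *\<^sub>R b) = s x + t"
      "\<And>x. x \<in> \<Omega> \<Longrightarrow> 0 < s x \<and> s x < L"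
    and u: "u \<in> eigenspace \<Omega> \<mu>" and nz: "\<not> (AE x in lebesgue_on \<Omega>. u x = 0)"
  shows "(pi / L)\<^sup>2 \<le> \<mu>"
proof -
  have u10: "u \<in> H10 \<Omega>" and form: "dirichlet_form \<Omega> u u = L2_inner \<Omega> (\<lambda>x. of_real \<mu> * u x) u"
    using u by (auto simp: eigenspace_def dirichlet_laplacian_def)
  then have uL2: "u \<in> L2 \<Omega>" by (auto simp: H10_def H1_def)
  have pos: "(L2_norm \<Omega> u)\<^sup>2 > 0"
  proof -
    have "(LINT x|lebesgue_on \<Omega>. (norm (u x))\<^sup>2) \<noteq> 0"
      using uL2 nz by (subst integral_nonneg_eq_0_iff_AE) (auto simp: L2_def)
    then show ?thesis by (simp add: L2_norm_sq less_le)
  qed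
  have "L2_inner \<Omega> (\<lambda>x. of_real \<mu> * u x) u = of_real \<mu> * L2_inner \<Omega> u u"
    by (simp add: L2_inner_def mult.assoc)
  then have "complex_of_real (\<Sum>b\<in>Basis. (L2_norm \<Omega> (weak_pd \<Omega> b u))\<^sup>2) = of_real (\<mu> * (L2_norm \<Omega> u)\<^sup>2)"
    using form by (simp add: dirichlet_form_def L2_inner_self)
  then have eq: "(\<Sum>b\<in>Basis. (L2_norm \<Omega> (weak_pd \<Omega> b u))\<^sup>2) = \<mu> * (L2_norm \<Omega> u)\<^sup>2"
    by (simp only: of_real_eq_iff)
  have "(pi / L * L2_norm \<Omega> u)\<^sup>2 \<le> (L2_norm \<Omega> (weak_pd \<Omega> b u))\<^sup>2"
    using \<open>L > 0\<close> L2_norm_nonneg[of \<Omega> u]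
    by (intro power_mono friedrichs_H10[OF \<Omega> b \<open>L > 0\<close> s u10]) auto
  also have "\<dots> \<le> (\<Sum>b\<in>Basis. (L2_norm \<Omega> (weak_pd \<Omega> b u))\<^sup>2)"
    by (rule member_le_sum[OF b]) auto
  finally show ?thesis
    using pos by (simp only: eq power_mult_distrib mult_le_cancel_right)
qed

text \<open>
  The value \<open>lam j\<close> occurs in the list, hence has positive multiplicity, and no member of a basis
  of its eigenspace vanishes almost everywhere.
\<close>

lemma listed_eigenvalue_has_eigenfunction:
  assumes "lists_eigenvalues_below \<Omega> \<beta> lam" "j \<ge> 1"
  obtains u where "u \<in> eigenspace \<Omega> (lam j)" "\<not> (AE x in lebesgue_on \<Omega>. u x = 0)"
proof -
  define n where "n = card {i. 1 \<le> i \<and> lam i = lam j}"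
  have "lam j < \<beta>" using assms by (auto simp: lists_eigenvalues_below_def)
  then have fin: "finite {i. 1 \<le> i \<and> lam i = lam j}" and mult: "has_multiplicity \<Omega> (lam j) n"
    using assms by (auto simp: lists_eigenvalues_below_def n_def)
  have "n > 0" unfolding n_def using fin assms(2) by (auto simp: card_gt_0_iff)
  from mult obtain e where e: "\<forall>i<n. e i \<in> eigenspace \<Omega> (lam j)"
    and ind: "\<And>c :: nat \<Rightarrow> complex. (AE x in lebesgue_on \<Omega>. (\<Sum>i<n. c i * e i x) = 0) \<Longrightarrow> \<forall>i<n. c i = 0"
    unfolding has_multiplicity_def by blast
  have sum0: "(\<Sum>i<n. (if i = 0 then 1 else 0) * e i x) = e 0 x" for x
    using \<open>n > 0\<close> by (simp add: if_distrib[of "\<lambda>c. c * _"] sum.delta cong: if_cong)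
  have "\<not> (AE x in lebesgue_on \<Omega>. e 0 x = 0)"
  proof
    assume "AE x in lebesgue_on \<Omega>. e 0 x = 0"
    then have "\<forall>i<n. (if i = 0 then 1 else 0 :: complex) = 0"
      by (intro ind) (simp only: sum0)
    from spec[OF this, of 0] show False using \<open>n > 0\<close> by simp
  qed
  then show ?thesis using that e \<open>n > 0\<close> by blast
qed

section \<open>The conical layer\<close>

text \<open>
  The width of the layer along the axis is \<open>L = 1 / sin \<theta>\<close>, with height function
  \<open>s = (z sin \<theta> - r cos \<theta>) / sin \<theta>\<close>.
\<close>

lemma conical_layer_eigenvalue_lower_bound:
  assumes \<theta>: "\<theta> \<in> {0<..<pi/2}" and "lists_eigenvalues_below (conical_layer \<theta>) \<beta> lam" "j \<ge> 1"
  shows "(pi * sin \<theta>)\<^sup>2 \<le> lam j"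
proof -
  have sin: "sin \<theta> > 0" using \<theta> by (intro sin_gt_zero) auto
  define q where "q p = p$3 * sin \<theta> - sqrt ((p$1)\<^sup>2 + (p$2)\<^sup>2) * cos \<theta>" for p :: "real^3"
  have layer: "conical_layer \<theta> = {p. 0 < q p \<and> q p < 1}"
    by (simp add: conical_layer_def q_def Let_def)
  have contq: "continuous_on UNIV q"
    unfolding q_def by (intro continuous_intros)
  have "open (conical_layer \<theta>)"
    unfolding layer using contq by (intro open_Collect_conj open_Collect_less) auto
  moreover have "axis 3 1 \<in> (Basis :: (real^3) set)" by (simp add: axis_in_Basis_iff)
  moreover have "1 / sin \<theta> > 0" using sin by simp
  moreover have "continuous_on UNIV (\<lambda>p. q p / sin \<theta>)"
    using contq sin by (intro continuous_intros) auto
  moreover have "q (p + t *\<^sub>R axis 3 1) / sin \<theta> = q p / sin \<theta> + t" for p t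
    using sin by (simp add: q_def axis_def field_simps)
  moreover have "0 < q p / sin \<theta> \<and> q p / sin \<theta> < 1 / sin \<theta>" if "p \<in> conical_layer \<theta>" for p
    using that sin by (simp add: layer divide_strict_right_mono)
  moreover obtain u where "u \<in> eigenspace (conical_layer \<theta>) (lam j)"
      "\<not> (AE x in lebesgue_on (conical_layer \<theta>). u x = 0)"
    using listed_eigenvalue_has_eigenfunction[OF assms(2,3)] .
  ultimately have "(pi / (1 / sin \<theta>))\<^sup>2 \<le> lam j"
    by (rule eigenvalue_lower_bound)
  then show ?thesis by simp
qed

theorem mainTheorem8:
  fixes lam :: "real \<Rightarrow> nat \<Rightarrow> real" and j :: nat
  assumes "\<And>\<theta>. \<theta> \<in> {0<..<pi/2} \<Longrightarrow> lists_eigenvalues_below (conical_layer \<theta>) (pi\<^sup>2) (lam \<theta>)"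
    and "j \<ge> 1"
  shows "((\<lambda>\<theta>. lam \<theta> j) \<longlongrightarrow> pi\<^sup>2) (at (pi/2) within {0<..<pi/2})"
proof (rule tendsto_sandwich)
  have in_range: "\<forall>\<^sub>F \<theta> in at (pi/2) within {0<..<pi/2}. \<theta> \<in> {0<..<pi/2}"
    by (simp add: eventually_at_filter)
  then show "\<forall>\<^sub>F \<theta> in at (pi/2) within {0<..<pi/2}. (pi * sin \<theta>)\<^sup>2 \<le> lam \<theta> j"
    by eventually_elim (rule conical_layer_eigenvalue_lower_bound[OF _ assms])
  from in_range show "\<forall>\<^sub>F \<theta> in at (pi/2) within {0<..<pi/2}. lam \<theta> j \<le> pi\<^sup>2"
    by eventually_elim (use assms in \<open>force simp: lists_eigenvalues_below_def\<close>)
  have "((\<lambda>\<theta>. (pi * sin \<theta>)\<^sup>2) \<longlongrightarrow> (pi * sin (pi/2))\<^sup>2) (at (pi/2) within {0<..<pi/2})"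
    by (intro tendsto_intros)
  then show "((\<lambda>\<theta>. (pi * sin \<theta>)\<^sup>2) \<longlongrightarrow> pi\<^sup>2) (at (pi/2) within {0<..<pi/2})"
    by simp
qed (rule tendsto_const)

end
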